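(* Let $m\ge 1$ and let $G=(N,E)$ be a finite directed graph whose edges are labeled by nonempty finite words over $\{1,\dots,m\}$. The set of entrywise-comparison Lyapunov inequalities represented by $G$ is a sufficient condition for stability if and only if $G$ is path-complete.
   Context: Words and products. For a word $w=w_1\cdots w_t$ over $\{1,\dots,m\}$ and square matrices $A_1,\dots,A_m$ of the same size, $A_w=A_{w_1}A_{w_2}\cdots A_{w_t}$. The mirror of $w$ is $\bar w=w_t\cdots w_1$. A word $u$ is a subword of a word $v$ if it appears in $v$ as a block of consecutive letters. Stability. A finite set $\Sigma=\{A_1,\dots,A_m\}\subset\mathbb{R}^{n\times n}$ is stable if for every switching signal $\sigma:\mathbb{N}\to\{1,\dots,m\}$ and every initial vector $x_0\in\mathbb{R}^n$, the trajectory $x_{k+1}=A_{\sigma(k)}x_k$ tends to $0$. Equivalently, the joint spectral radius $\rho(\Sigma)=\lim_{k\to\infty}\max_{\sigma\in\{1,\dots,m\}^k}\|A_{\sigma_k}\cdots A_{\sigma_1}\|^{1/k}$ is $<1$. Entrywise-comparison Lyapunov functions. For an entrywise positive vector $p\in\mathbb{R}^n$ define, for entrywise nonnegative $x\in\mathbb{R}^n_+$, $V_p(x)=\inf\{\lambda>0: x/\lambda\le p\}$, the inequality being entrywise. These functions are used with entrywise nonnegative matrices. Graph of a set of Lyapunov inequalities. Each node $i\in N$ stands for an unknown Lyapunov function $V_i$, and each edge from node $i$ to node $j$ with label $\bar w$ stands for the inequality $V_j(A_wx)<V_i(x)$ for all nonzero $x$ in the domain. A set $\Sigma=\{A_1,\dots,A_m\}$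 of entrywise nonnegative $n\times n$ matrices satisfies the entrywise-comparison Lyapunov inequalities represented by $G$ if there exist entrywise positive vectors $p_i\in\mathbb{R}^n$ ($i\in N$) such that for every edge from $i$ to $j$ with label $\bar w$, $V_{p_j}(A_wx)<V_{p_i}(x)$ for all $x\in\mathbb{R}^n_+\setminus\{0\}$. The set of inequalities is a sufficient condition for stability if, for every $n\ge1$, every set $\Sigma=\{A_1,\dots,A_m\}$ of entrywise nonnegative $n\times n$ matrices satisfying them is stable. Path-completeness. $G$ is path-complete if for every finite word $u$ over $\{1,\dots,m\}$ there is a directed path in $G$ such that the word obtained by concatenating the labels of the edges along the path contains $u$ as a subword. *)

theory Defs
  imports Complex_Main "HOL-Library.Sublist"
    "Jordan_Normal_Form.Matrix" "Graph_Theory.Graph_Theory"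
begin

definition mat_word :: "nat \<Rightarrow> (nat \<Rightarrow> real mat) \<Rightarrow> nat list \<Rightarrow> real mat" where
  "mat_word n A w = foldr (\<lambda>i M. A i * M) w (1\<^sub>m n)"

primrec trajectory :: "(nat \<Rightarrow> real mat) \<Rightarrow> (nat \<Rightarrow> nat) \<Rightarrow> real vec \<Rightarrow> nat \<Rightarrow> real vec" where
  "trajectory A \<sigma> x0 0 = x0"
| "trajectory A \<sigma> x0 (Suc k) = A (\<sigma> k) *\<^sub>v trajectory A \<sigma> x0 k"

text \<open>Vectors of variable dimension carry no topology in the library, so convergence
  to zero is taken coordinatewise.\<close>

definition stable :: "nat \<Rightarrow> nat \<Rightarrow> (nat \<Rightarrow> real mat) \<Rightarrow> bool" where
  "stable n m A \<longleftrightarrow>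
     (\<forall>\<sigma>. (\<forall>k. \<sigma> k \<in> {1..m}) \<longrightarrow>
        (\<forall>x0 \<in> carrier_vec n. \<forall>i < n. (\<lambda>k. trajectory A \<sigma> x0 k $ i) \<longlonglongrightarrow> 0))"

definition nonneg_family :: "nat \<Rightarrow> nat \<Rightarrow> (nat \<Rightarrow> real mat) \<Rightarrow> bool" where
  "nonneg_family n m A \<longleftrightarrow> (\<forall>i \<in> {1..m}. A i \<in> carrier_mat n n \<and> 0\<^sub>m n n \<le> A i)"

definition pos_vec :: "nat \<Rightarrow> real vec \<Rightarrow> bool" where
  "pos_vec n p \<longleftrightarrow> p \<in> carrier_vec n \<and> (\<forall>i < n. 0 < p $ i)"

text \<open>The order on vectors is entrywise. The infimum is over a nonempty set bounded below
  whenever the positive vector and the argument have the same dimension.\<close>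

definition V :: "real vec \<Rightarrow> real vec \<Rightarrow> real" where
  "V p x = Inf {l. 0 < l \<and> (1 / l) \<cdot>\<^sub>v x \<le> p}"

text \<open>An arc carries the mirror of the word whose matrix product occurs in its inequality,
  hence the reversal of the label.\<close>

definition satisfies_lyapunov ::
    "('v, 'e) pre_digraph \<Rightarrow> ('e \<Rightarrow> nat list) \<Rightarrow> nat \<Rightarrow> (nat \<Rightarrow> real mat) \<Rightarrow> bool" where
  "satisfies_lyapunov G lab n A \<longleftrightarrow>
     (\<exists>p :: 'v \<Rightarrow> real vec.
        (\<forall>i \<in> verts G. pos_vec n (p i)) \<and>
        (\<forall>e \<in> arcs G. \<forall>x \<in> carrier_vec n. 0\<^sub>v n \<le> x \<longrightarrow> x \<noteq> 0\<^sub>v n \<longrightarrow>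
           V (p (head G e)) (mat_word n A (rev (lab e)) *\<^sub>v x) < V (p (tail G e)) x))"

definition sufficient_for_stability ::
    "nat \<Rightarrow> ('v, 'e) pre_digraph \<Rightarrow> ('e \<Rightarrow> nat list) \<Rightarrow> bool" where
  "sufficient_for_stability m G lab \<longleftrightarrow>
     (\<forall>n \<ge> 1. \<forall>A. nonneg_family n m A \<longrightarrow> satisfies_lyapunov G lab n A \<longrightarrow> stable n m A)"

text \<open>Directed paths may repeat vertices and arcs, so they are walks
  (\<open>awalk\<close>, not \<open>apath\<close>). The predicate \<open>sublist\<close> means contiguous block.\<close>

definition path_complete ::
    "nat \<Rightarrow> ('v, 'e) pre_digraph \<Rightarrow> ('e \<Rightarrow> nat list) \<Rightarrow> bool" where
  "path_complete m G lab \<longleftrightarrow>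
     (\<forall>u \<in> lists {1..m}. \<exists>i es j. pre_digraph.awalk G i es j \<and> sublist u (concat (map lab es)))"

end

theory Submission
  imports Defs
begin

text \<open>
  For nonnegative matrices and positive vectors \<open>p\<close>, \<open>q\<close>, the inequality
  \<open>V\<^sub>q(B x) < V\<^sub>p(x)\<close> for all nonzero \<open>x \<ge> 0\<close> says exactly that \<open>B p < q\<close> in every entry: the
  vector \<open>p\<close> is the largest element of the sublevel set \<open>V\<^sub>p \<le> 1\<close>. A solution of the Lyapunov
  inequalities is therefore a choice of positive vectors \<open>p\<^sub>i\<close> with \<open>A\<^sub>l p\<^sub>i < p\<^sub>j\<close> for every arc
  from \<open>i\<close> to \<open>j\<close>, where \<open>A\<^sub>l\<close> applies the letters of the arc label in the order in which they
  are read (\<open>satisfies_lyapunov_iff\<close>).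

  Suppose the graph is path-complete. There are finitely many arcs and coordinates, so one
  \<open>\<delta> < 1\<close> satisfies \<open>A\<^sub>l p\<^sub>i \<le> \<delta>\<^sup>h p\<^sub>j\<close> for every arc, with \<open>h\<close> the length of its label. Any word occurs
  inside the label of a walk, so unless it lies in a single label it is a suffix of one label,
  then a product of full labels, then a prefix of one label. The full labels contract at rate \<open>\<delta>\<close> per letter, and the two ends
  have bounded length and cost only a constant. Hence products of length \<open>t\<close> are \<open>O(\<delta>\<^sup>t)\<close>, and
  all trajectories vanish (\<open>path_complete_imp_stable\<close>).

  Suppose a word is never read inside the label of a walk, and extend it to a nonempty such
  word \<open>w\<close>. Place the coordinates on a cycle of length \<open>|w|\<close>, and let the matrix of the letter \<open>l\<close>
  move coordinate \<open>s\<close> to \<open>s + 1\<close> if \<open>w\<^sub>s = l\<close> and delete it otherwise. The switching signal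
  \<open>w w w ...\<close> carries a coordinate around for ever, so this family is not stable
  (\<open>shift_mat_not_stable\<close>). But every block of length \<open>2 |w|\<close> of the periodic word contains \<open>w\<close>,
  so only walks of bounded length have labels that occur in it. Let entry \<open>k\<close> of \<open>p\<^sub>i\<close> be one
  plus the greatest number of arcs of a walk that ends at \<open>i\<close> and whose label can be read from
  the cycle so as to end at position \<open>k\<close>. Appending an arc lengthens the walk, which gives the
  required strict inequalities (\<open>shift_mat_satisfies_lyapunov\<close>).
\<close>

section \<open>Products acting on vectors\<close>

text \<open>The first letter acts first, so words are read in the order of time, as arc labels are.\<close>

definition run :: "(nat \<Rightarrow> real mat) \<Rightarrow> nat list \<Rightarrow> real vec \<Rightarrow> real vec" where
  "run A w v = fold (\<lambda>l x. A l *\<^sub>v x) w v"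

lemma run_simps [simp]:
  "run A [] v = v"
  "run A (l # w) v = run A w (A l *\<^sub>v v)"
  "run A (u @ w) v = run A w (run A u v)"
  by (simp_all add: run_def)

lemma nonneg_familyD:
  assumes "nonneg_family n m A" "l \<in> {1..m}"
  shows "A l \<in> carrier_mat n n" "0\<^sub>m n n \<le> A l"
  using assms by (auto simp: nonneg_family_def)

lemma run_carrier:
  assumes "nonneg_family n m A" "w \<in> lists {1..m}" "v \<in> carrier_vec n"
  shows "run A w v \<in> carrier_vec n"
  using assms(2,3)
proof (induction w arbitrary: v)
  case (Cons l w)
  then show ?case
    using nonneg_familyD(1)[OF assms(1)] by (auto intro!: Cons.IH mult_mat_vec_carrier)
qed simp

lemma mat_word_carrier:
  assumes "nonneg_family n m A" "w \<in> lists {1..m}"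
  shows "mat_word n A w \<in> carrier_mat n n"
  using assms(2)
proof (induction w)
  case (Cons l w)
  then show ?case
    using nonneg_familyD(1)[OF assms(1), of l]
    by (auto simp: mat_word_def intro: mult_carrier_mat)
qed (simp add: mat_word_def)

lemma mat_word_rev_eq_run:
  assumes "nonneg_family n m A" "w \<in> lists {1..m}" "v \<in> carrier_vec n"
  shows "mat_word n A (rev w) *\<^sub>v v = run A w v"
  using assms(2)
proof (induction w rule: rev_induct)
  case Nil
  then show ?case using assms(3) by (simp add: mat_word_def)
next
  case (snoc l w)
  then have l: "l \<in> {1..m}" and w: "w \<in> lists {1..m}" by auto
  then have w': "rev w \<in> lists {1..m}" by (simp add: in_lists_conv_set)
  have "mat_word n A (rev (w @ [l])) = A l * mat_word n A (rev w)"
    by (simp add: mat_word_def)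
  also have "\<dots> *\<^sub>v v = A l *\<^sub>v (mat_word n A (rev w) *\<^sub>v v)"
    using nonneg_familyD(1)[OF assms(1) l] mat_word_carrier[OF assms(1) w'] assms(3)
    by (intro assoc_mult_mat_vec)
  finally show ?case using snoc.IH[OF w] by simp
qed

lemma trajectory_eq_run: "trajectory A \<sigma> x k = run A (map \<sigma> [0..<k]) x"
  by (induction k) simp_all

lemma smult_mono_vec:
  fixes v w :: "real vec"
  assumes "v \<le> w" "0 \<le> c"
  shows "c \<cdot>\<^sub>v v \<le> c \<cdot>\<^sub>v w"
  using assms by (simp add: less_eq_vec_def mult_left_mono)

lemma nonneg_mat_vec_mono:
  fixes v w :: "real vec"
  assumes "B \<in> carrier_mat n n" "0\<^sub>m n n \<le> B" "v \<le> w" "w \<in> carrier_vec n"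
  shows "B *\<^sub>v v \<le> B *\<^sub>v w"
proof -
  have dims: "dim_row B = n" "dim_col B = n" "dim_vec v = n" "dim_vec w = n"
    using assms by (auto simp: less_eq_vec_def)
  have "(\<Sum>j = 0..<n. B $$ (i, j) * v $ j) \<le> (\<Sum>j = 0..<n. B $$ (i, j) * w $ j)"
    if "i < n" for i
  proof (intro sum_mono mult_left_mono)
    fix j assume "j \<in> {0..<n}"
    then show "v $ j \<le> w $ j" "0 \<le> B $$ (i, j)"
      using that assms dims by (simp_all add: less_eq_vec_def less_eq_mat_def)
  qed
  then show ?thesis
    using dims by (simp add: less_eq_vec_def scalar_prod_def)
qed

lemma run_mono:
  assumes "nonneg_family n m A" "w \<in> lists {1..m}" "v \<le> v'" "v' \<in> carrier_vec n"
  shows "run A w v \<le> run A w v'"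
  using assms(2-4)
proof (induction w arbitrary: v v')
  case (Cons l w)
  then show ?case
    using nonneg_familyD[OF assms(1), of l]
    by (auto intro!: Cons.IH nonneg_mat_vec_mono mult_mat_vec_carrier)
qed simp

lemma run_smult:
  assumes "nonneg_family n m A" "w \<in> lists {1..m}" "v \<in> carrier_vec n"
  shows "run A w (c \<cdot>\<^sub>v v) = c \<cdot>\<^sub>v run A w v"
  using assms(2,3)
proof (induction w arbitrary: v)
  case (Cons l w)
  then show ?case
    using nonneg_familyD(1)[OF assms(1), of l] by (simp add: mult_mat_vec)
qed simp

text \<open>This is how one-step estimates are chained: a bound by a multiple of \<open>p\<close> followed by an
  estimate of the image of \<open>p\<close> multiplies the two constants.\<close>

lemma run_le_smult:
  assumes "nonneg_family n m A" "w \<in> lists {1..m}" "p \<in> carrier_vec n"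
    and "v \<le> c \<cdot>\<^sub>v p" "run A w p \<le> d \<cdot>\<^sub>v q" "0 \<le> c"
  shows "run A w v \<le> (c * d) \<cdot>\<^sub>v q"
proof -
  have "run A w v \<le> run A w (c \<cdot>\<^sub>v p)"
    using assms by (intro run_mono[OF assms(1,2)]) auto
  also have "\<dots> = c \<cdot>\<^sub>v run A w p" by (rule run_smult[OF assms(1-3)])
  also have "\<dots> \<le> c \<cdot>\<^sub>v (d \<cdot>\<^sub>v q)" by (rule smult_mono_vec[OF assms(5,6)])
  finally show ?thesis by (simp add: smult_smult_assoc)
qed

lemma smult_le_smult:
  fixes p :: "real vec"
  assumes "c \<le> d" "0\<^sub>v n \<le> p" "p \<in> carrier_vec n"
  shows "c \<cdot>\<^sub>v p \<le> d \<cdot>\<^sub>v p"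
  using assms by (simp add: less_eq_vec_def mult_right_mono)

section \<open>Entrywise-comparison functions\<close>

text \<open>For \<open>l > 0\<close> the condition \<open>x / l \<le> p\<close> means that \<open>l\<close> bounds all ratios of entries. The
  infimum is taken over positive \<open>l\<close> only, hence the separate case in which all ratios vanish
  and the infimum is not attained.\<close>

lemma V_eq_Max:
  assumes "1 \<le> n" "pos_vec n p" "x \<in> carrier_vec n" "0\<^sub>v n \<le> x"
  shows "V p x = Max ((\<lambda>k. x $ k / p $ k) ` {..<n})"
proof -
  let ?S = "(\<lambda>k. x $ k / p $ k) ` {..<n}"
  let ?M = "Max ?S"
  have p: "p \<in> carrier_vec n" "\<And>k. k < n \<Longrightarrow> 0 < p $ k"
    using assms(2) by (auto simp: pos_vec_def)
  have ne: "?S \<noteq> {}" using assms(1) by (auto simp: lessThan_empty_iff)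
  have M0: "0 \<le> ?M"
  proof -
    have "x $ 0 / p $ 0 \<le> ?M" using assms(1) by (intro Max_ge) auto
    moreover have "0 \<le> x $ 0 / p $ 0"
      using assms p(2)[of 0] by (auto simp: less_eq_vec_def)
    ultimately show ?thesis by linarith
  qed
  have iff: "(1 / l) \<cdot>\<^sub>v x \<le> p \<longleftrightarrow> ?M \<le> l" if "0 < l" for l
  proof -
    have "(1 / l) \<cdot>\<^sub>v x \<le> p \<longleftrightarrow> (\<forall>k<n. x $ k / l \<le> p $ k)"
      using assms(3) p(1) by (auto simp: less_eq_vec_def)
    also have "\<dots> \<longleftrightarrow> (\<forall>k<n. x $ k / p $ k \<le> l)"
      using that p(2) by (auto simp: field_simps)
    also have "\<dots> \<longleftrightarrow> ?M \<le> l"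
      using ne by (subst Max_le_iff) auto
    finally show ?thesis .
  qed
  have "V p x = Inf {l. 0 < l \<and> ?M \<le> l}"
    unfolding V_def using iff by (intro arg_cong[of _ _ Inf]) auto
  also have "\<dots> = ?M"
  proof (cases "?M = 0")
    case True
    have "{l. 0 < l \<and> ?M \<le> l} = {0<..}" using True by auto
    then show ?thesis using True by simp
  next
    case False
    then have "{l. 0 < l \<and> ?M \<le> l} = {?M..}" using M0 by auto
    then show ?thesis by simp
  qed
  finally show ?thesis .
qed

text \<open>Testing the inequality on \<open>x = p\<close>, where \<open>V\<close> equals 1, gives the entrywise inequality.
  Conversely \<open>x \<le> V\<^sub>p(x) p\<close>, and applying the nonnegative product keeps this bound.\<close>

lemma V_decrease_iff:
  assumes n: "1 \<le> n" and A: "nonneg_family n m A" and w: "w \<in> lists {1..m}"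
    and p: "pos_vec n p" and q: "pos_vec n q"
  shows "(\<forall>x \<in> carrier_vec n. 0\<^sub>v n \<le> x \<longrightarrow> x \<noteq> 0\<^sub>v n \<longrightarrow> V q (run A w x) < V p x)
    \<longleftrightarrow> (\<forall>k<n. run A w p $ k < q $ k)" (is "?L \<longleftrightarrow> ?R")
proof -
  have pc: "p \<in> carrier_vec n" "\<And>k. k < n \<Longrightarrow> 0 < p $ k"
    and qc: "q \<in> carrier_vec n" "\<And>k. k < n \<Longrightarrow> 0 < q $ k"
    using p q by (auto simp: pos_vec_def)
  have ne: "{..<n} \<noteq> {}" using n by (auto simp: lessThan_empty_iff)
  have smult0: "0 \<cdot>\<^sub>v x = 0\<^sub>v n" if "x \<in> carrier_vec n" for x :: "real vec"
    using that by (intro eq_vecI) auto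
  have zero: "run A w (0\<^sub>v n) = 0\<^sub>v n"
    using run_smult[OF A w, of "0\<^sub>v n" 0] run_carrier[OF A w, of "0\<^sub>v n"]
    by (simp add: smult0)
  have nonneg: "0\<^sub>v n \<le> run A w x" if "x \<in> carrier_vec n" "0\<^sub>v n \<le> x" for x
    using run_mono[OF A w that(2) that(1)] zero by simp
  have V_run: "V q (run A w x) = Max ((\<lambda>k. run A w x $ k / q $ k) ` {..<n})"
    if "x \<in> carrier_vec n" "0\<^sub>v n \<le> x" for x
    using that nonneg run_carrier[OF A w] by (intro V_eq_Max[OF n q]) auto
  show ?thesis
  proof
    assume L: ?L
    have p0: "0\<^sub>v n \<le> p" using pc by (auto simp: less_eq_vec_def intro: less_imp_le)
    have "p \<noteq> 0\<^sub>v n" using pc(2)[of 0] n by auto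
    then have "V q (run A w p) < V p p" using L pc p0 by auto
    moreover have "V p p = 1"
    proof -
      have "(\<lambda>k. p $ k / p $ k) ` {..<n} = {1}"
        using pc(2) ne by (auto simp: image_def) (metis less_irrefl)+
      then show ?thesis using V_eq_Max[OF n p pc(1) p0] by simp
    qed
    ultimately have "Max ((\<lambda>k. run A w p $ k / q $ k) ` {..<n}) < 1"
      using V_run[OF pc(1) p0] by simp
    then have "\<forall>k<n. run A w p $ k / q $ k < 1"
      using ne by (subst (asm) Max_less_iff) auto
    then show ?R using qc(2) by (auto simp: field_simps)
  next
    assume R: ?R
    show ?L
    proof (intro ballI impI)
      fix x :: "real vec"
      assume x: "x \<in> carrier_vec n" "0\<^sub>v n \<le> x" "x \<noteq> 0\<^sub>v n"
      let ?t = "V p x"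
      have t: "?t = Max ((\<lambda>k. x $ k / p $ k) ` {..<n})" by (rule V_eq_Max[OF n p x(1,2)])
      have le: "x $ k / p $ k \<le> ?t" if "k < n" for k
        unfolding t using that by (intro Max_ge) auto
      obtain k where k: "k < n" "x $ k \<noteq> 0"
        using x(1,3) by (metis eq_vecI carrier_vecD index_zero_vec)
      have "0 < x $ k" using x k by (auto simp: less_eq_vec_def order_less_le)
      then have "0 < x $ k / p $ k" using pc(2)[OF k(1)] by simp
      then have t0: "0 < ?t" using le[OF k(1)] by linarith
      have "x \<le> ?t \<cdot>\<^sub>v p"
        using le x(1) pc by (auto simp: less_eq_vec_def field_simps)
      then have "run A w x \<le> run A w (?t \<cdot>\<^sub>v p)" using pc by (intro run_mono[OF A w]) auto
      also have "\<dots> = ?t \<cdot>\<^sub>v run A w p" by (rule run_smult[OF A w pc(1)])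
      finally have *: "run A w x $ k \<le> ?t * run A w p $ k" if "k < n" for k
        using that run_carrier[OF A w pc(1)] by (auto simp: less_eq_vec_def)
      have "run A w x $ k / q $ k < ?t" if "k < n" for k
      proof -
        have "run A w x $ k < ?t * q $ k"
          using *[OF that] R t0 that by (meson le_less_trans mult_strict_left_mono)
        then show ?thesis using qc(2)[OF that] by (simp add: field_simps)
      qed
      then show "V q (run A w x) < ?t"
        unfolding V_run[OF x(1,2)] using ne by (subst Max_less_iff) auto
    qed
  qed
qed

lemma satisfies_lyapunov_iff:
  assumes "1 \<le> n" "nonneg_family n m A" "wf_digraph G"
    and "\<And>e. e \<in> arcs G \<Longrightarrow> lab e \<in> lists {1..m}"
  shows "satisfies_lyapunov G lab n A \<longleftrightarrow>
    (\<exists>p. (\<forall>i \<in> verts G. pos_vec n (p i)) \<and>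
      (\<forall>e \<in> arcs G. \<forall>k<n. run A (lab e) (p (tail G e)) $ k < p (head G e) $ k))"
proof -
  interpret wf_digraph G by fact
  have "(\<forall>x \<in> carrier_vec n. 0\<^sub>v n \<le> x \<longrightarrow> x \<noteq> 0\<^sub>v n \<longrightarrow>
           V (p (head G e)) (mat_word n A (rev (lab e)) *\<^sub>v x) < V (p (tail G e)) x)
      \<longleftrightarrow> (\<forall>k<n. run A (lab e) (p (tail G e)) $ k < p (head G e) $ k)"
    if "\<forall>i \<in> verts G. pos_vec n (p i)" "e \<in> arcs G" for p e
    using that assms(4) V_decrease_iff[OF assms(1,2) assms(4), of e "p (tail G e)" "p (head G e)"]
    by (simp add: mat_word_rev_eq_run[OF assms(2)])
  then show ?thesis
    unfolding satisfies_lyapunov_def by (intro ex_cong1 conj_cong refl ball_cong) blast+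
qed

section \<open>Path-completeness implies stability\<close>

lemma finite_strict_factor:
  fixes f g :: "'a \<Rightarrow> real"
  assumes "finite S" "\<And>s. s \<in> S \<Longrightarrow> f s < g s" "\<And>s. s \<in> S \<Longrightarrow> 0 < g s"
  obtains c where "0 < c" "c < 1" "\<And>s. s \<in> S \<Longrightarrow> f s \<le> c * g s"
proof
  let ?c = "Max (insert (1/2) ((\<lambda>s. f s / g s) ` S))"
  show "0 < ?c" using assms(1) by (intro less_le_trans[OF _ Max_ge[of _ "1/2"]]) auto
  show "?c < 1" using assms by (subst Max_less_iff) auto
  show "f s \<le> ?c * g s" if "s \<in> S" for s
  proof -
    have "f s / g s \<le> ?c" using assms(1) that by (intro Max_ge) auto
    then show ?thesis using assms(3)[OF that] by (simp add: field_simps)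
  qed
qed

lemma finite_upper_bound:
  fixes f :: "'a \<Rightarrow> real"
  assumes "finite S"
  obtains c where "1 \<le> c" "\<And>s. s \<in> S \<Longrightarrow> f s \<le> c"
proof
  show "1 \<le> Max (insert 1 (f ` S))" using assms by (intro Max_ge) auto
  show "f s \<le> Max (insert 1 (f ` S))" if "s \<in> S" for s using assms that by (intro Max_ge) auto
qed

definition ones :: "nat \<Rightarrow> real vec" where
  "ones n = vec n (\<lambda>_. 1)"

lemma ones_simps [simp]:
  "ones n \<in> carrier_vec n" "0\<^sub>v n \<le> ones n" "k < n \<Longrightarrow> ones n $ k = 1" "dim_vec (ones n) = n"
  by (auto simp: ones_def less_eq_vec_def)

lemma run_growth:
  assumes A: "nonneg_family n m A"
  obtains M where "1 \<le> M"
    "\<And>w. w \<in> lists {1..m} \<Longrightarrow> run A w (ones n) \<le> M ^ length w \<cdot>\<^sub>v ones n"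
proof -
  obtain M where M: "1 \<le> M"
    "\<And>s. s \<in> {1..m} \<times> {..<n} \<Longrightarrow> (A (fst s) *\<^sub>v ones n) $ snd s \<le> M"
    using finite_upper_bound[of "{1..m} \<times> {..<n}" "\<lambda>s. (A (fst s) *\<^sub>v ones n) $ snd s"] by auto
  have step: "A l *\<^sub>v ones n \<le> M \<cdot>\<^sub>v ones n" if "l \<in> {1..m}" for l
    using M(2)[of "(l, _)"] that nonneg_familyD(1)[OF A that]
    by (simp add: less_eq_vec_def)
  have "run A w (ones n) \<le> M ^ length w \<cdot>\<^sub>v ones n" if "w \<in> lists {1..m}" for w
    using that
  proof (induction w)
    case (Cons l w)
    then have w: "w \<in> lists {1..m}" and l: "l \<in> {1..m}" by auto
    show ?case
      using run_le_smult[OF A w ones_simps(1) step[OF l] Cons.IH] M(1) by simp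
  qed (simp add: less_eq_vec_def)
  with M(1) show ?thesis by (rule that)
qed

text \<open>The strict inequalities on arcs are turned into geometric decay per letter. A word is
  estimated first when it is a prefix of the label of a walk (\<open>prefix\<close>), then anywhere inside
  such a label (\<open>infix_bound\<close>); in both cases by induction on the walk.\<close>

theorem path_complete_imp_stable:
  assumes G: "fin_digraph G"
    and lab: "\<And>e. e \<in> arcs G \<Longrightarrow> lab e \<noteq> [] \<and> lab e \<in> lists {1..m}"
    and pc: "path_complete m G lab"
    and n: "1 \<le> n" and A: "nonneg_family n m A" and ly: "satisfies_lyapunov G lab n A"
  shows "stable n m A"
proof -
  interpret fin_digraph G by fact
  obtain p where p: "\<And>i. i \<in> verts G \<Longrightarrow> pos_vec n (p i)"
    and dec: "\<And>e k. e \<in> arcs G \<Longrightarrow> k < n \<Longrightarrow> run A (lab e) (p (tail G e)) $ k < p (head G e) $ k"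
    using ly satisfies_lyapunov_iff[OF n A wf_digraph, of lab] lab by blast
  have pcar: "p i \<in> carrier_vec n" and ppos: "\<And>k. k < n \<Longrightarrow> 0 < p i $ k" if "i \<in> verts G" for i
    using p[OF that] by (auto simp: pos_vec_def)
  have runcar: "run A w v \<in> carrier_vec n" if "w \<in> lists {1..m}" "v \<in> carrier_vec n" for w v
    using that by (rule run_carrier[OF A])
  obtain \<gamma> where \<gamma>: "0 < \<gamma>" "\<gamma> < 1"
    "\<And>s. s \<in> arcs G \<times> {..<n} \<Longrightarrow>
       run A (lab (fst s)) (p (tail G (fst s))) $ snd s \<le> \<gamma> * p (head G (fst s)) $ snd s"
    by (rule finite_strict_factor[of "arcs G \<times> {..<n}"
          "\<lambda>s. run A (lab (fst s)) (p (tail G (fst s))) $ snd s"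
          "\<lambda>s. p (head G (fst s)) $ snd s"]) (auto intro: dec ppos)
  define L where "L = Suc (Max (insert 0 ((\<lambda>e. length (lab e)) ` arcs G)))"
  have L: "length (lab e) \<le> L" if "e \<in> arcs G" for e
    unfolding L_def using that by (intro le_SucI Max_ge) auto
  \<comment> \<open>No label is longer than \<open>L\<close>, so a contraction by \<open>\<gamma> = \<delta> ^ L\<close> along an arc is at least a
     contraction by \<open>\<delta>\<close> per letter.\<close>
  define \<delta> where "\<delta> = root L \<gamma>"
  have "0 < L" by (simp add: L_def)
  then have \<delta>: "0 < \<delta>" "\<delta> < 1" "\<delta> ^ L = \<gamma>"
    using \<gamma>(1,2) by (simp_all add: \<delta>_def)
  have \<delta>_le: "\<delta> ^ L \<le> \<delta> ^ j" if "j \<le> L" for j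
    using \<delta> that by (intro power_decreasing) auto
  have arc: "run A (lab e) (p (tail G e)) \<le> \<delta> ^ length (lab e) \<cdot>\<^sub>v p (head G e)"
    if e: "e \<in> arcs G" for e
  proof -
    have car: "run A (lab e) (p (tail G e)) \<in> carrier_vec n" "p (head G e) \<in> carrier_vec n"
      using e lab[OF e] pcar by (simp_all add: runcar)
    have "run A (lab e) (p (tail G e)) $ k \<le> \<delta> ^ length (lab e) * p (head G e) $ k" if k: "k < n" for k
    proof -
      have "run A (lab e) (p (tail G e)) $ k \<le> \<gamma> * p (head G e) $ k"
        using \<gamma>(3)[of "(e, k)"] e k by simp
      also have "\<dots> \<le> \<delta> ^ length (lab e) * p (head G e) $ k"
        using \<delta>_le[OF L[OF e]] ppos[of "head G e" k] e k \<delta>(3) by (intro mult_right_mono) auto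
      finally show ?thesis .
    qed
    then show ?thesis using car by (simp add: less_eq_vec_def)
  qed
  \<comment> \<open>The partial labels at the two ends of a word are estimated on \<open>ones n\<close>; the constants
     \<open>P1\<close> and \<open>P2\<close> are the cost of passing from some \<open>p i\<close> to \<open>ones n\<close> and back.\<close>
  obtain P1 where P1: "1 \<le> P1" "\<And>s. s \<in> verts G \<times> {..<n} \<Longrightarrow> p (fst s) $ snd s \<le> P1"
    by (rule finite_upper_bound[of "verts G \<times> {..<n}" "\<lambda>s. p (fst s) $ snd s"]) auto
  obtain P2 where P2: "1 \<le> P2" "\<And>s. s \<in> verts G \<times> {..<n} \<Longrightarrow> 1 / p (fst s) $ snd s \<le> P2"
    by (rule finite_upper_bound[of "verts G \<times> {..<n}" "\<lambda>s. 1 / p (fst s) $ snd s"]) auto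
  have p_le: "p i \<le> P1 \<cdot>\<^sub>v ones n" if "i \<in> verts G" for i
    using P1(2)[of "(i, _)"] pcar[OF that] that by (simp add: less_eq_vec_def)
  have ones_le: "ones n \<le> P2 \<cdot>\<^sub>v p i" if i: "i \<in> verts G" for i
  proof -
    have "1 \<le> P2 * p i $ k" if "k < n" for k
      using P2(2)[of "(i, k)"] ppos[OF i that] i that by (simp add: field_simps)
    then show ?thesis using pcar[OF i] by (simp add: less_eq_vec_def)
  qed
  obtain M where M: "1 \<le> M"
    "\<And>w. w \<in> lists {1..m} \<Longrightarrow> run A w (ones n) \<le> M ^ length w \<cdot>\<^sub>v ones n"
    using run_growth[OF A] by blast
  \<comment> \<open>Words of length at most \<open>L\<close> grow by at most \<open>M ^ L\<close>; dividing by \<open>\<delta> ^ L\<close> lets them obey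
     the same decay estimate as full labels.\<close>
  define C where "C = M ^ L / \<delta> ^ L"
  have C0: "0 \<le> C" using M(1) \<delta>(1) by (simp add: C_def)
  have short_word: "run A w (ones n) \<le> (C * \<delta> ^ length w) \<cdot>\<^sub>v ones n"
    if "w \<in> lists {1..m}" "length w \<le> L" for w
  proof -
    have "M ^ length w \<le> M ^ L" using M(1) that by (intro power_increasing) auto
    also have "\<dots> = C * \<delta> ^ L" using \<delta>(1) by (simp add: C_def)
    also have "\<dots> \<le> C * \<delta> ^ length w" using C0 \<delta>_le[OF that(2)] by (intro mult_left_mono)
    finally have "M ^ length w \<cdot>\<^sub>v ones n \<le> (C * \<delta> ^ length w) \<cdot>\<^sub>v ones n"
      by (intro smult_le_smult[OF _ ones_simps(2,1)])
    with M(2)[OF that(1)] show ?thesis by (rule order_trans)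
  qed
  have lists_walk: "concat (map lab es) \<in> lists {1..m}" if "awalk i es j" for i es j
  proof -
    have "\<forall>e \<in> set es. lab e \<in> lists {1..m}" using that lab unfolding awalk_def by blast
    then show ?thesis by (induction es) simp_all
  qed
  have prefix: "run A u (p i) \<le> (P1 * C * \<delta> ^ length u) \<cdot>\<^sub>v ones n"
    if "awalk i es j" "concat (map lab es) = u @ y" for i es j u y
    using that
  proof (induction es arbitrary: i u)
    case Nil
    then show ?case
      using run_le_smult[OF A _ ones_simps(1) p_le short_word, of u i] P1(1) by (auto simp: awalk_Nil_iff)
  next
    case (Cons e es)
    then have e: "e \<in> arcs G" "i = tail G e" and es: "awalk (head G e) es j"
      by (auto simp: awalk_Cons_iff)
    then have i: "i \<in> verts G" by simp
    have "u @ y \<in> lists {1..m}" using Cons.prems lists_walk by metis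
    then have u: "u \<in> lists {1..m}" by simp
    consider "length u \<le> length (lab e)"
      | u' where "u = lab e @ u'" "concat (map lab es) = u' @ y"
      using Cons.prems(2) by (auto simp: append_eq_append_conv2)
    then show ?case
    proof cases
      case 1
      then have "length u \<le> L" using L[OF e(1)] by simp
      then show ?thesis
        using run_le_smult[OF A u ones_simps(1) p_le[OF i] short_word[OF u]] P1(1)
        by (simp add: mult.assoc)
    next
      case (2 u')
      then have u': "u' \<in> lists {1..m}" using u by simp
      have "run A u' (run A (lab e) (p i))
          \<le> (\<delta> ^ length (lab e) * (P1 * C * \<delta> ^ length u')) \<cdot>\<^sub>v ones n"
        using arc[OF e(1)] Cons.IH[OF es 2(2)] e \<delta>(1) pcar[OF head_in_verts[OF e(1)]]
        by (intro run_le_smult[OF A u', of "p (head G e)" _ "\<delta> ^ length (lab e)"]) simp_all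
      then show ?thesis using 2(1) by (simp add: power_add algebra_simps)
    qed
  qed
  \<comment> \<open>The product is the cost of a partial label, a change to \<open>p\<close>, full labels and a last partial
     label; the summand \<open>C\<close> covers words inside a single label.\<close>
  define K where "K = C * (P2 * (P1 * C)) + C"
  have K: "C \<le> K" "C * (P2 * (P1 * C)) \<le> K"
    using C0 P1(1) P2(1) by (simp_all add: K_def)
  have weaken: "run A u v \<le> (K * \<delta> ^ length u) \<cdot>\<^sub>v ones n"
    if "run A u v \<le> (c * \<delta> ^ length u) \<cdot>\<^sub>v ones n" "c \<le> K" for u v c
    using that(2) \<delta>(1)
    by (intro order_trans[OF that(1)] smult_le_smult[OF _ ones_simps(2,1)] mult_right_mono) auto
  have infix_bound: "run A u (ones n) \<le> (K * \<delta> ^ length u) \<cdot>\<^sub>v ones n"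
    if "awalk i es j" "concat (map lab es) = x @ u @ y" for i es j x u y
    using that
  proof (induction es arbitrary: i x)
    case Nil
    then show ?case using weaken[OF short_word K(1), of "[]"] by simp
  next
    case (Cons e es)
    then have e: "e \<in> arcs G" and es: "awalk (head G e) es j"
      by (auto simp: awalk_Cons_iff)
    then have i: "head G e \<in> verts G" by simp
    have "x @ u @ y \<in> lists {1..m}" using Cons.prems lists_walk by metis
    then have u: "u \<in> lists {1..m}" by simp
    have eq: "lab e @ concat (map lab es) = x @ u @ y" using Cons.prems(2) by simp
    consider x' where "x = lab e @ x'" "concat (map lab es) = x' @ u @ y"
      | s where "lab e = x @ s" "s @ concat (map lab es) = u @ y"
      using eq by (auto simp: append_eq_append_conv2)
    then show ?case
    proof cases
      case (1 x')
      then show ?thesis using Cons.IH[OF es] by blast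
    next
      case (2 s)
      consider "length u \<le> length s" | u' where "u = s @ u'" "concat (map lab es) = u' @ y"
        using 2(2) by (auto simp: append_eq_append_conv2)
      then show ?thesis
      proof cases
        case 1
        then have "length u \<le> L" using L[OF e] 2(1) by simp
        then show ?thesis by (rule weaken[OF short_word[OF u] K(1)])
      next
        case (2 u')
        then have s: "s \<in> lists {1..m}" and u': "u' \<in> lists {1..m}" using u by auto
        have "length s \<le> L" using L[OF e] \<open>lab e = x @ s\<close> by simp
        note sb = short_word[OF s this]
        have "run A u' (ones n) \<le> (P2 * (P1 * C * \<delta> ^ length u')) \<cdot>\<^sub>v ones n"
          using P2(1) by (intro run_le_smult[OF A u' pcar[OF i] ones_le[OF i] prefix[OF es 2(2)]]) simp
        then have "run A u' (run A s (ones n))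
            \<le> (C * \<delta> ^ length s * (P2 * (P1 * C * \<delta> ^ length u'))) \<cdot>\<^sub>v ones n"
          using C0 \<delta>(1) by (simp add: run_le_smult[OF A u' ones_simps(1) sb])
        then have "run A u (ones n) \<le> (C * (P2 * (P1 * C)) * \<delta> ^ length u) \<cdot>\<^sub>v ones n"
          using 2(1) by (simp add: power_add mult_ac)
        then show ?thesis by (rule weaken[OF _ K(2)])
      qed
    qed
  qed
  have bound: "run A u (ones n) \<le> (K * \<delta> ^ length u) \<cdot>\<^sub>v ones n"
    if u: "u \<in> lists {1..m}" for u
  proof -
    obtain i es j where "awalk i es j" "sublist u (concat (map lab es))"
      using pc u unfolding path_complete_def by blast
    then show ?thesis using infix_bound by (auto simp: sublist_def)
  qed
  show ?thesis
    unfolding stable_def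
  proof (intro allI ballI impI)
    fix \<sigma> :: "nat \<Rightarrow> nat" and x :: "real vec" and k
    assume \<sigma>: "\<forall>t. \<sigma> t \<in> {1..m}" and x: "x \<in> carrier_vec n" and k: "k < n"
    obtain c where c: "1 \<le> c" "\<And>k. k \<in> {..<n} \<Longrightarrow> \<bar>x $ k\<bar> \<le> c"
      by (rule finite_upper_bound[of "{..<n}" "\<lambda>k. \<bar>x $ k\<bar>"]) auto
    \<comment> \<open>The start vector may have entries of both signs, so it is enclosed between two multiples
       of \<open>ones n\<close>.\<close>
    have upper: "x \<le> c \<cdot>\<^sub>v ones n" and lower: "(- c) \<cdot>\<^sub>v ones n \<le> x"
      using x c(2) by (auto simp: less_eq_vec_def abs_le_iff minus_le_iff)
    have "norm (trajectory A \<sigma> x t $ k) \<le> norm (c * K * \<delta> ^ t) * 1" for t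
    proof -
      let ?u = "map \<sigma> [0..<t]"
      have u: "?u \<in> lists {1..m}" using \<sigma> by auto
      let ?r = "run A ?u (ones n)"
      have r: "?r \<in> carrier_vec n" "?r $ k \<le> K * \<delta> ^ t"
        using bound[OF u] runcar[OF u ones_simps(1)] k by (auto simp: less_eq_vec_def)
      have "run A ?u x \<le> c \<cdot>\<^sub>v ?r"
        using run_mono[OF A u upper] run_smult[OF A u ones_simps(1)] by simp
      moreover have "(- c) \<cdot>\<^sub>v ?r \<le> run A ?u x"
        using run_mono[OF A u lower x] run_smult[OF A u ones_simps(1)] by simp
      ultimately have "run A ?u x $ k \<le> c * ?r $ k" "- (c * ?r $ k) \<le> run A ?u x $ k"
        using r(1) runcar[OF u x] k by (auto simp: less_eq_vec_def)
      moreover have "c * ?r $ k \<le> c * (K * \<delta> ^ t)"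
        using r(2) c(1) by (intro mult_left_mono) auto
      ultimately have "\<bar>run A ?u x $ k\<bar> \<le> c * (K * \<delta> ^ t)" by linarith
      also have "\<dots> \<le> \<bar>c * (K * \<delta> ^ t)\<bar>" by (rule abs_ge_self)
      finally show ?thesis by (simp only: trajectory_eq_run mult.assoc real_norm_def mult_1_right)
    qed
    then have "\<forall>\<^sub>F t in sequentially.
        norm (trajectory A \<sigma> x t $ k) \<le> norm (c * K * \<delta> ^ t) * 1"
      by (intro always_eventually allI)
    moreover have "(\<lambda>t. c * K * \<delta> ^ t) \<longlonglongrightarrow> 0"
      using \<delta>(1,2) by (intro tendsto_mult_right_zero LIMSEQ_power_zero) auto
    ultimately show "(\<lambda>t. trajectory A \<sigma> x t $ k) \<longlonglongrightarrow> 0"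
      by (rule tendsto_0_le[rotated])
  qed
qed

section \<open>A system that survives only one periodic word\<close>

text \<open>With the convention that column \<open>j\<close> is mapped to row \<open>i\<close>, this is the adjacency matrix of
  the \<open>l\<close>-labelled arcs of the directed cycle spelling \<open>w\<close>.\<close>

definition shift_mat :: "nat list \<Rightarrow> nat \<Rightarrow> real mat" where
  "shift_mat w l = mat (length w) (length w)
     (\<lambda>(i, j). if i = Suc j mod length w \<and> w ! j = l then 1 else 0)"

text \<open>The word \<open>v\<close> occurs in the infinite periodic word \<open>w w w ...\<close> at position \<open>s\<close>.\<close>

definition reads :: "nat list \<Rightarrow> nat \<Rightarrow> nat list \<Rightarrow> bool" where
  "reads w s v \<longleftrightarrow> (\<forall>t<length v. v ! t = w ! ((s + t) mod length w))"

lemma reads_Nil [simp]: "reads w s []"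
  by (simp add: reads_def)

lemma reads_Cons: "reads w s (l # v) \<longleftrightarrow> l = w ! (s mod length w) \<and> reads w (Suc s) v"
  by (auto simp: reads_def All_less_Suc2)

lemma reads_append: "reads w s (u @ v) \<longleftrightarrow> reads w s u \<and> reads w (s + length u) v"
  by (induction u arbitrary: s) (auto simp: reads_Cons)

lemma reads_mod: "s mod length w = s' mod length w \<Longrightarrow> reads w s v \<longleftrightarrow> reads w s' v"
  unfolding reads_def by (metis mod_add_left_eq)

text \<open>The first multiple of the period at or after \<open>s\<close> is fewer than \<open>|w|\<close> letters away, and a full copy
  of \<open>w\<close> starts there.\<close>

lemma reads_long_contains:
  assumes "reads w s v" "2 * length w \<le> length v" "w \<noteq> []"
  shows "sublist w v"
proof -
  let ?n = "length w"
  \<comment> \<open>\<open>(|w| - 1) s\<close> is congruent to \<open>- s\<close> modulo \<open>|w|\<close> and avoids truncated subtraction.\<close>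
  define a where "a = (?n - 1) * s mod ?n"
  have n: "0 < ?n" using assms(3) by simp
  then have a: "a < ?n" by (simp add: a_def)
  have "(s + a) mod ?n = (s + (?n - 1) * s) mod ?n" by (simp add: a_def mod_add_right_eq)
  also have "s + (?n - 1) * s = ?n * s" using n by (cases ?n) auto
  finally have sa: "(s + a) mod ?n = 0" by simp
  have "take ?n (drop a v) = w"
  proof (rule nth_equalityI)
    fix t assume "t < length (take ?n (drop a v))"
    then have t: "t < ?n" "a + t < length v" using a assms(2) by auto
    have "v ! (a + t) = w ! ((s + (a + t)) mod ?n)" using assms(1) t by (auto simp: reads_def)
    also have "(s + (a + t)) mod ?n = ((s + a) mod ?n + t) mod ?n" by (simp add: mod_simps add.assoc)
    also have "\<dots> = t" using sa t by simp
    finally show "take ?n (drop a v) ! t = w ! t" using t by simp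
  qed (use a assms(2) in simp)
  then have "v = take a v @ w @ drop ?n (drop a v)"
    by (metis append_take_drop_id)
  then show ?thesis by (metis sublist_appendI)
qed

lemma shift_mat_carrier [simp]: "shift_mat w l \<in> carrier_mat (length w) (length w)"
  by (simp add: shift_mat_def)

lemma shift_mat_nonneg_family: "nonneg_family (length w) m (shift_mat w)"
  by (auto simp: nonneg_family_def less_eq_mat_def shift_mat_def)

lemma Suc_mod_eq_iff:
  assumes "j < n"
  shows "Suc s mod n = Suc j mod n \<longleftrightarrow> j = s mod n"
  using assms by (auto simp: mod_Suc)

lemma shift_mat_mult_index:
  assumes "w \<noteq> []" "x \<in> carrier_vec (length w)"
  shows "(shift_mat w l *\<^sub>v x) $ (Suc s mod length w)
    = (if w ! (s mod length w) = l then x $ (s mod length w) else 0)"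
proof -
  let ?n = "length w"
  have n: "0 < ?n" using assms(1) by simp
  have "(shift_mat w l *\<^sub>v x) $ (Suc s mod ?n)
      = (\<Sum>j = 0..<?n. (if Suc s mod ?n = Suc j mod ?n \<and> w ! j = l then 1 else 0) * x $ j)"
    using n assms(2) by (simp add: shift_mat_def scalar_prod_def)
  also have "\<dots> = (\<Sum>j = 0..<?n. if j = s mod ?n then (if w ! j = l then x $ j else 0) else 0)"
    by (intro sum.cong refl) (auto simp: Suc_mod_eq_iff)
  also have "\<dots> = (if w ! (s mod ?n) = l then x $ (s mod ?n) else 0)"
    using n by (subst sum.delta) auto
  finally show ?thesis .
qed

text \<open>A product kills a coordinate unless its word can be read from that position of the
  cycle; otherwise the coordinate is moved past the word.\<close>

lemma run_shift_mat_index: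
  assumes "w \<noteq> []" "x \<in> carrier_vec (length w)"
  shows "run (shift_mat w) v x $ ((s + length v) mod length w)
    = (if reads w s v then x $ (s mod length w) else 0)"
  using assms(2)
proof (induction v arbitrary: s x)
  case (Cons l v)
  have "shift_mat w l *\<^sub>v x \<in> carrier_vec (length w)"
    using Cons.prems by (intro mult_mat_vec_carrier) auto
  from Cons.IH[OF this, of "Suc s"] show ?case
    using shift_mat_mult_index[OF assms(1) Cons.prems, of l s] by (auto simp: reads_Cons)
qed simp

lemma shift_mat_not_stable:
  assumes "w \<noteq> []" "w \<in> lists {1..m}"
  shows "\<not> stable (length w) m (shift_mat w)"
proof
  let ?n = "length w"
  define \<sigma> where "\<sigma> k = w ! (k mod ?n)" for k
  have n: "0 < ?n" using assms(1) by simp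
  have \<sigma>: "\<sigma> k \<in> {1..m}" for k
    using assms n by (auto simp: \<sigma>_def in_lists_conv_set)
  assume "stable ?n m (shift_mat w)"
  then have "(\<lambda>k. trajectory (shift_mat w) \<sigma> (ones ?n) k $ 0) \<longlonglongrightarrow> 0"
    using \<sigma> n unfolding stable_def by auto
  then have "(\<lambda>r. trajectory (shift_mat w) \<sigma> (ones ?n) (r * ?n) $ 0) \<longlonglongrightarrow> 0"
    using n by (intro LIMSEQ_subseq_LIMSEQ[unfolded comp_def, of _ _ "\<lambda>r. r * ?n"])
      (auto simp: strict_mono_def)
  moreover have "trajectory (shift_mat w) \<sigma> (ones ?n) (r * ?n) $ 0 = 1" for r
  proof -
    have "reads w 0 (map \<sigma> [0..<r * ?n])" by (simp add: reads_def \<sigma>_def)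
    then show ?thesis
      using run_shift_mat_index[OF assms(1) ones_simps(1), of "map \<sigma> [0..<r * ?n]" 0] n
      by (simp add: trajectory_eq_run)
  qed
  ultimately show False by (simp add: LIMSEQ_const_iff)
qed

text \<open>A walk whose label occurs in the periodic word has fewer than \<open>2 |w|\<close> arcs, since labels are
  nonempty and a longer label would contain \<open>w\<close>. The longest such walk with prescribed end
  vertex and end position is thus a finite rank, and it increases along every arc
  whose label can be read.\<close>

lemma shift_mat_satisfies_lyapunov:
  assumes G: "fin_digraph G" and w: "w \<noteq> []"
    and lab: "\<And>e. e \<in> arcs G \<Longrightarrow> lab e \<noteq> [] \<and> lab e \<in> lists {1..m}"
    and missing: "\<And>i es j. pre_digraph.awalk G i es j \<Longrightarrow> \<not> sublist w (concat (map lab es))"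
  shows "satisfies_lyapunov G lab (length w) (shift_mat w)"
proof -
  interpret fin_digraph G by fact
  let ?n = "length w" and ?cat = "\<lambda>es. concat (map lab es)"
  have n: "0 < ?n" "1 \<le> ?n" using w by (simp_all add: Suc_le_eq)
  define R where "R i k = {length es | es a s. awalk a es i \<and> reads w s (?cat es)
      \<and> (s + length (?cat es)) mod ?n = k}" for i k
  have length_le: "length es \<le> length (?cat es)" if "set es \<subseteq> arcs G" for es
    using that
  proof (induction es)
    case (Cons e es)
    then have "1 \<le> length (lab e)" using lab by (simp add: Suc_le_eq)
    then show ?case using Cons by simp
  qed simp
  have "length es < 2 * ?n" if "awalk a es i" "reads w s (?cat es)" for a es i s
  proof -
    have "length es \<le> length (?cat es)" using that(1) by (intro length_le) (auto simp: awalk_def)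
    also have "\<dots> < 2 * ?n"
      using reads_long_contains[OF that(2) _ w] missing[OF that(1)] by (meson not_le)
    finally show ?thesis .
  qed
  then have "R i k \<subseteq> {..<2 * ?n}" for i k by (auto simp: R_def)
  then have finR: "finite (R i k)" for i k by (rule finite_subset) simp
  have neR: "R i k \<noteq> {}" if "i \<in> verts G" "k < ?n" for i k
  proof -
    have "awalk i [] i \<and> reads w k (?cat []) \<and> (k + length (?cat [])) mod ?n = k"
      using that by (simp add: awalk_Nil_iff)
    then show ?thesis unfolding R_def by blast
  qed
  define p where "p i = vec ?n (\<lambda>k. 1 + real (Max (R i k)))" for i
  have p: "pos_vec ?n (p i)" for i by (auto simp: pos_vec_def p_def)
  have "run (shift_mat w) (lab e) (p (tail G e)) $ k < p (head G e) $ k"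
    if e: "e \<in> arcs G" and k: "k < ?n" for e k
  proof -
    let ?i = "tail G e" and ?j = "head G e"
    \<comment> \<open>The position from which reading the label ends at \<open>k\<close>.\<close>
    define s where "s = (k + (?n - 1) * length (lab e)) mod ?n"
    have "(s + length (lab e)) mod ?n = (k + (?n - 1) * length (lab e) + length (lab e)) mod ?n"
      by (simp add: s_def mod_simps)
    also have "k + (?n - 1) * length (lab e) + length (lab e) = k + ?n * length (lab e)"
      using n(1) by (cases ?n) auto
    finally have s: "(s + length (lab e)) mod ?n = k" using k by simp
    have sn: "s < ?n" using n by (simp add: s_def)
    have val: "run (shift_mat w) (lab e) (p ?i) $ k = (if reads w s (lab e) then p ?i $ s else 0)"
      using run_shift_mat_index[OF w, of "p ?i" "lab e" s] p[of ?i] s sn by (simp add: pos_vec_def)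
    show ?thesis
    proof (cases "reads w s (lab e)")
      case False
      then show ?thesis using val p[of ?j] k by (simp add: pos_vec_def)
    next
      case True
      have "Max (R ?i s) \<in> R ?i s" using finR neR e sn by (intro Max_in) auto
      then obtain es a s' where es: "Max (R ?i s) = length es" "awalk a es ?i"
        "reads w s' (?cat es)" "(s' + length (?cat es)) mod ?n = s"
        unfolding R_def by blast
      have "awalk a (es @ [e]) ?j"
        using es(2) e by (intro awalk_appendI[of _ _ ?i]) (auto simp: awalk_simps)
      moreover have "reads w (s' + length (?cat es)) (lab e)"
        using reads_mod[of "s' + length (?cat es)" w s] es(4) True sn by simp
      then have "reads w s' (?cat (es @ [e]))" using es(3) by (simp add: reads_append)
      moreover have "(s' + length (?cat (es @ [e]))) mod ?n = k"
        using s es(4) by (simp flip: add.assoc) (metis mod_add_left_eq)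
      ultimately have "length (es @ [e]) \<in> R ?j k" unfolding R_def by blast
      then have "length (es @ [e]) \<le> Max (R ?j k)" by (rule Max_ge[OF finR])
      then show ?thesis using val True es(1) sn k by (simp add: p_def)
    qed
  qed
  then show ?thesis
    using p satisfies_lyapunov_iff[OF n(2) shift_mat_nonneg_family wf_digraph, of lab] lab by blast
qed

theorem theorem5:
  fixes m :: nat and G :: "('v, 'e) pre_digraph" and lab :: "'e \<Rightarrow> nat list"
  assumes "1 \<le> m"
    and "fin_digraph G"
    and "\<And>e. e \<in> arcs G \<Longrightarrow> lab e \<noteq> [] \<and> lab e \<in> lists {1..m}"
  shows "sufficient_for_stability m G lab \<longleftrightarrow> path_complete m G lab"
proof
  assume "path_complete m G lab"
  then show "sufficient_for_stability m G lab"
    using path_complete_imp_stable[where lab = lab, OF assms(2,3)]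
    by (auto simp: sufficient_for_stability_def)
next
  assume suff: "sufficient_for_stability m G lab"
  show "path_complete m G lab"
  proof (rule ccontr)
    assume "\<not> path_complete m G lab"
    then obtain u where u: "u \<in> lists {1..m}"
      "\<And>i es j. pre_digraph.awalk G i es j \<Longrightarrow> \<not> sublist u (concat (map lab es))"
      unfolding path_complete_def by blast
    \<comment> \<open>The empty word is missed when there are no vertices, and a cycle of length 0 would be
       useless; an extension of a missed word is missed too.\<close>
    define w where "w = u @ [1]"
    have w: "w \<noteq> []" "w \<in> lists {1..m}" using u(1) assms(1) by (auto simp: w_def)
    have "sublist u w" by (simp add: w_def)
    then have "\<not> sublist w (concat (map lab es))" if "pre_digraph.awalk G i es j" for i es j
      using u(2)[OF that] by (meson sublist_order.order_trans)
    then have "satisfies_lyapunov G lab (length w) (shift_mat w)"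
      using shift_mat_satisfies_lyapunov[where lab = lab, OF assms(2) w(1) assms(3)]
      by blast
    then have "stable (length w) m (shift_mat w)"
      using suff w(1) shift_mat_nonneg_family unfolding sufficient_for_stability_def
      by (simp add: Suc_le_eq)
    then show False using shift_mat_not_stable[OF w] by simp
  qed
qed

end
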